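(* Let $S,Y\in\mathbb{R}^{n\times m}$ be of full rank, with $n\ge m$, and let $\|\cdot\|$ denote the Frobenius norm. (i) The unique solution to $\min_{B\in\mathbb{R}^{m\times m}}\|Y-SB\|$ is $B=(S^TS)^{-1}S^TY$. (ii) The unique solution to $\min_{H\in\mathbb{R}^{m\times m}}\|YH-S\|$ is $H=(Y^TY)^{-1}Y^TS$. (iii) In the quadratic case, i.e., when $S$ and $Y$ are the matrices of iterate differences and gradient differences of the gradient method applied to $f(x)=\tfrac12x^TAx-b^Tx$ with $A\in\mathbb{R}^{n\times n}$ symmetric positive definite (so that $Y=AS$), the eigenvalues of the matrix $B$ in (i) are the Ritz values of $A$ and the eigenvalues of the matrix $H$ in (ii) are the inverses of the harmonic Ritz values of $A$, both with respect to the subspace $\mathcal{S}$ spanned by the columns of $S$.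
   Context: Here $b\in\mathbb{R}^n$. In the quadratic case, the gradient method is $x_{k+1}=x_k-\beta_kg_k$ with $g_k=\nabla f(x_k)=Ax_k-b$, $\beta_k>0$, and the columns of $S$ and $Y$ are $s_k=x_{k+1}-x_k$ and $y_k=g_{k+1}-g_k$, $k=1,\dots,m$. Let $\mathcal{S}$ be the column space of $S$. The Ritz values of $A$ (with respect to $\mathcal{S}$) are the scalars $\theta$ for which there is a nonzero $c\in\mathbb{R}^m$ with $ASc-\theta Sc\perp\mathcal{S}$; equivalently, the eigenvalues of the pencil $(S^TY,\,S^TS)$. The harmonic Ritz values of $A$ (with respect to $\mathcal{S}$) are the scalars $\tilde\theta$ for which there is a nonzero $\tilde c\in\mathbb{R}^m$ with $AS\tilde c-\tilde\theta S\tilde c\perp A\mathcal{S}$; equivalently, $\tilde\theta^{-1}$ are the eigenvalues of the pencil $(Y^TS,\,Y^TY)$. An eigenvalue of a pencil $(M,N)$ is a scalar $\mu$ with $Mc=\mu Nc$ for some nonzero $c$. *)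

theory Defs
  imports "HOL-Analysis.Analysis"
begin

definition full_rank :: "real^'m^'n \<Rightarrow> bool" where
  "full_rank M \<longleftrightarrow> rank M = min CARD('n) CARD('m)"

text \<open>The library norm on \<open>real^'m^'n\<close> is the Frobenius norm.\<close>

lemma norm_matrix_frobenius:
  fixes M :: "real^'m^'n"
  shows "norm M = sqrt (\<Sum>i\<in>UNIV. \<Sum>j\<in>UNIV. (M $ i $ j)\<^sup>2)"
  by (simp add: norm_vec_def L2_set_def real_sqrt_pow2 sum_nonneg)

definition spd_matrix :: "real^'n^'n \<Rightarrow> bool" where
  "spd_matrix A \<longleftrightarrow> transpose A = A \<and> (\<forall>v. v \<noteq> 0 \<longrightarrow> v \<bullet> (A *v v) > 0)"

text \<open>Eigenvalues of a real square matrix are taken over the complex numbers.\<close>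

definition matrix_eigenvalues :: "real^'m^'m \<Rightarrow> complex set" where
  "matrix_eigenvalues M =
     {\<mu>. \<exists>c::complex^'m. c \<noteq> 0 \<and> map_matrix complex_of_real M *v c = \<mu> *s c}"

text \<open>
  In the next two definitions, \<open>span (columns S)\<close> is the subspace with respect to which
  the values are taken.
\<close>

definition ritz_values :: "real^'n^'n \<Rightarrow> real^'m^'n \<Rightarrow> real set" where
  "ritz_values A S =
     {\<theta>. \<exists>c. c \<noteq> 0 \<and>
        A *v (S *v c) - \<theta> *\<^sub>R (S *v c) \<in> orthogonal_comp (span (columns S))}"

definition harmonic_ritz_values :: "real^'n^'n \<Rightarrow> real^'m^'n \<Rightarrow> real set" where
  "harmonic_ritz_values A S =
     {\<theta>. \<exists>c. c \<noteq> 0 \<and>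
        A *v (S *v c) - \<theta> *\<^sub>R (S *v c) \<in> orthogonal_comp ((*v) A ` span (columns S))}"

definition quadratic :: "real^'n^'n \<Rightarrow> real^'n \<Rightarrow> real^'n \<Rightarrow> real" where
  "quadratic A b x = 1/2 * (x \<bullet> (A *v x)) - b \<bullet> x"

text \<open>
  \<open>m\<close> steps of the gradient method for \<open>f\<close>, with iterates \<open>x 1, \<dots>, x (m + 1)\<close>,
  gradients \<open>g 1, \<dots>, g (m + 1)\<close> and step lengths \<open>\<beta> 1, \<dots>, \<beta> m\<close>.
\<close>

definition gradient_method ::
  "('a::real_inner \<Rightarrow> real) \<Rightarrow> nat \<Rightarrow> (nat \<Rightarrow> 'a) \<Rightarrow> (nat \<Rightarrow> 'a) \<Rightarrow> (nat \<Rightarrow> real) \<Rightarrow> bool" where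
  "gradient_method f m x g \<beta> \<longleftrightarrow>
     (\<forall>k\<in>{1..m + 1}. GDERIV f (x k) :> g k) \<and>
     (\<forall>k\<in>{1..m}. \<beta> k > 0 \<and> x (k + 1) = x k - \<beta> k *\<^sub>R g k)"

text \<open>
  The matrix with columns \<open>v (k + 1) - v k\<close>, \<open>k = 1, \<dots>, m\<close>. The index type \<open>'m\<close> carries no
  order, so \<open>idx\<close>, a bijection from \<open>'m\<close> onto \<open>{1..CARD('m)}\<close>, tells the position of each column.
\<close>

definition difference_matrix :: "('m \<Rightarrow> nat) \<Rightarrow> (nat \<Rightarrow> real^'n) \<Rightarrow> real^'m^'n" where
  "difference_matrix idx v = (\<chi> i j. (v (idx j + 1) - v (idx j)) $ i)"

end

theory Submission
  imports Defs
begin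

text \<open>
  Everything reduces to two kinds of square matrices. If the columns of \<open>S\<close> are independent, the
  Gram matrix \<open>S\<^sup>T S\<close> is symmetric positive definite, and so is \<open>S\<^sup>T A S\<close> for every symmetric
  positive definite \<open>A\<close> (\<open>spd_congruence\<close>).

  For the least squares problems, the residual \<open>R\<close> of the claimed solution satisfies the normal
  equations \<open>S\<^sup>T R = 0\<close>, so \<open>R\<close> is orthogonal, in the Frobenius inner product, to every matrix
  \<open>S D\<close>. A candidate that differs by \<open>D \<noteq> 0\<close> has the residual \<open>R + S D\<close> up to the sign of
  \<open>D\<close>, whose squared norm exceeds that of \<open>R\<close> by \<open>\<parallel>S D\<parallel>\<^sup>2 > 0\<close>
  (\<open>least_squares_unique_minimizer\<close>).

  In the quadratic case the gradient is \<open>A x - b\<close>, hence \<open>Y = A S\<close>. Both pairs of matrices in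
  the eigenvalue problems then consist of the symmetric matrix \<open>S\<^sup>T Y = Y\<^sup>T S = S\<^sup>T A S\<close> and a
  positive definite Gram matrix, and orthogonality to a column space says that the transposed
  matrix annihilates the vector. Thus the Ritz values are the real eigenvalues of the pencil
  \<open>(S\<^sup>T A S, S\<^sup>T S)\<close>, and the harmonic ones those of \<open>(Y\<^sup>T Y, Y\<^sup>T S)\<close>; exchanging the
  two matrices of a pencil inverts its eigenvalues, none of which is zero here. What remains is that
  \<open>G\<^sup>-\<^sup>1 K\<close>, which need not be symmetric, has no complex eigenvalues beyond these real ones
  (\<open>matrix_eigenvalues_inverse_times\<close>).
\<close>

section \<open>Positive definite matrices and Gram matrices\<close>

lemma inner_matrix_vector_transpose:
  fixes M :: "real^'m^'n"
  shows "x \<bullet> (M *v y) = (transpose M *v x) \<bullet> y"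
  by (simp add: dot_lmul_matrix)

lemma inner_symmetric_matrix:
  fixes K :: "real^'m^'m"
  assumes "transpose K = K"
  shows "x \<bullet> (K *v y) = y \<bullet> (K *v x)"
  by (metis assms inner_commute inner_matrix_vector_transpose)

lemma full_rank_imp_inj:
  fixes M :: "real^'m^'n"
  assumes "CARD('m) \<le> CARD('n)" and "full_rank M"
  shows "inj ((*v) M)"
  using assms by (simp add: full_rank_def full_rank_injective)

lemma spd_matrix_kernel:
  assumes "spd_matrix A" and "A *v x = 0"
  shows "x = 0"
  using assms unfolding spd_matrix_def by (metis inner_zero_right less_irrefl)

lemma spd_matrix_invertible:
  assumes "spd_matrix A"
  shows "invertible A"
  using spd_matrix_kernel[OF assms] by (auto simp: invertible_left_inverse matrix_left_invertible_ker)

lemma mult_matrix_inv: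
  fixes A :: "real^'n^'n"
  assumes "invertible A"
  shows "A ** matrix_inv A = mat 1"
  using someI_ex[OF assms[unfolded invertible_def]] by (simp add: matrix_inv_def)

lemma spd_congruence:
  fixes A :: "real^'n^'n" and S :: "real^'m^'n"
  assumes A: "spd_matrix A" and S: "inj ((*v) S)"
  shows "spd_matrix (transpose S ** (A ** S))"
  unfolding spd_matrix_def
proof (intro conjI allI impI)
  show "transpose (transpose S ** (A ** S)) = transpose S ** (A ** S)"
    using A by (simp add: spd_matrix_def matrix_transpose_mul matrix_mul_assoc)
next
  fix v :: "real^'m"
  assume "v \<noteq> 0"
  then have "S *v v \<noteq> 0"
    using S by (metis injD matrix_vector_mult_0_right)
  then have "(S *v v) \<bullet> (A *v (S *v v)) > 0"
    using A by (simp add: spd_matrix_def)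
  also have "(S *v v) \<bullet> (A *v (S *v v)) = v \<bullet> ((transpose S ** (A ** S)) *v v)"
    unfolding matrix_vector_mul_assoc[symmetric] inner_matrix_vector_transpose[of v]
    by simp
  finally show "v \<bullet> ((transpose S ** (A ** S)) *v v) > 0" .
qed

lemma spd_gram_matrix:
  fixes S :: "real^'m^'n"
  assumes "inj ((*v) S)"
  shows "spd_matrix (transpose S ** S)"
proof -
  have "spd_matrix (mat 1 :: real^'n^'n)"
    by (simp add: spd_matrix_def)
  from spd_congruence[OF this assms] show ?thesis
    by simp
qed

section \<open>Least squares in the Frobenius norm\<close>

text \<open>
  For the Frobenius inner product, left multiplication by \<open>S\<^sup>T\<close> is the adjoint of left
  multiplication by \<open>S\<close>; this is what turns orthogonality into the normal equations.
\<close>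

lemma inner_matrix_mult_transpose:
  fixes X :: "real^'k^'n" and S :: "real^'m^'n" and D :: "real^'k^'m"
  shows "X \<bullet> (S ** D) = (transpose S ** X) \<bullet> D"
proof -
  have "X \<bullet> (S ** D) = (\<Sum>i\<in>UNIV. \<Sum>j\<in>UNIV. \<Sum>l\<in>UNIV. X $ i $ j * (S $ i $ l * D $ l $ j))"
    by (simp add: inner_vec_def matrix_matrix_mult_def sum_distrib_left)
  also have "\<dots> = (\<Sum>i\<in>UNIV. \<Sum>l\<in>UNIV. \<Sum>j\<in>UNIV. X $ i $ j * (S $ i $ l * D $ l $ j))"
    by (intro sum.cong refl sum.swap)
  also have "\<dots> = (\<Sum>l\<in>UNIV. \<Sum>i\<in>UNIV. \<Sum>j\<in>UNIV. X $ i $ j * (S $ i $ l * D $ l $ j))"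
    by (rule sum.swap)
  also have "\<dots> = (\<Sum>l\<in>UNIV. \<Sum>j\<in>UNIV. \<Sum>i\<in>UNIV. X $ i $ j * (S $ i $ l * D $ l $ j))"
    by (intro sum.cong refl sum.swap)
  also have "\<dots> = (transpose S ** X) \<bullet> D"
    by (simp add: inner_vec_def matrix_matrix_mult_def transpose_def sum_distrib_left sum_distrib_right mult_ac)
  finally show ?thesis .
qed

lemma matrix_mult_diff_distrib:
  fixes A :: "real^'m^'n" and B C :: "real^'k^'m"
  shows "A ** (B - C) = A ** B - A ** C"
  by (simp add: vec_eq_iff matrix_matrix_mult_def right_diff_distrib sum_subtractf)

lemma inj_matrix_mult_eq_0:
  fixes S :: "real^'m^'n" and D :: "real^'k^'m"
  assumes S: "inj ((*v) S)" and D: "S ** D = 0"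
  shows "D = 0"
proof -
  obtain L where "L ** S = mat 1"
    using S matrix_left_invertible_injective[of S] by blast
  then have "D = L ** (S ** D)"
    by (simp add: matrix_mul_assoc)
  then show ?thesis
    by (simp add: D)
qed

text \<open>
  Pythagoras: the residual at the solution of the normal equations is orthogonal to the range of
  \<open>D \<mapsto> S ** D\<close>, which is injective.
\<close>

lemma least_squares_unique_minimizer:
  fixes S :: "real^'m^'n" and Y :: "real^'k^'n"
  assumes S: "inj ((*v) S)"
  shows "{B. is_arg_min (\<lambda>B. norm (Y - S ** B)) (\<lambda>_. True) B} =
    {matrix_inv (transpose S ** S) ** (transpose S ** Y)}"
proof -
  define C where "C = matrix_inv (transpose S ** S) ** (transpose S ** Y)"
  have "invertible (transpose S ** S)"
    by (intro spd_matrix_invertible spd_gram_matrix S)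
  then have "(transpose S ** S) ** C = transpose S ** Y"
    by (simp add: C_def matrix_mul_assoc mult_matrix_inv)
  then have normal_eq: "transpose S ** (Y - S ** C) = 0"
    by (simp add: matrix_mult_diff_distrib matrix_mul_assoc)
  have pythagoras: "(norm (Y - S ** B))\<^sup>2 = (norm (Y - S ** C))\<^sup>2 + (norm (S ** (C - B)))\<^sup>2" for B
  proof -
    have "Y - S ** B = (Y - S ** C) + S ** (C - B)"
      by (simp add: matrix_mult_diff_distrib)
    moreover have "orthogonal (Y - S ** C) (S ** (C - B))"
      by (simp add: orthogonal_def inner_matrix_mult_transpose normal_eq)
    ultimately show ?thesis
      by (simp only: norm_add_Pythagorean)
  qed
  have le: "norm (Y - S ** C) \<le> norm (Y - S ** B)" for B
    by (rule power2_le_imp_le) (simp_all add: pythagoras[of B])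
  have less: "norm (Y - S ** C) < norm (Y - S ** B)" if "B \<noteq> C" for B
  proof -
    have "S ** (C - B) \<noteq> 0"
      using inj_matrix_mult_eq_0[OF S] that by (metis right_minus_eq)
    then have "(norm (S ** (C - B)))\<^sup>2 > 0"
      by simp
    then have "(norm (Y - S ** C))\<^sup>2 < (norm (Y - S ** B))\<^sup>2"
      unfolding pythagoras[of B] by linarith
    then show ?thesis
      by (rule power2_less_imp_less) simp
  qed
  show ?thesis
    unfolding C_def[symmetric] is_arg_min_def
  proof (intro equalityI subsetI)
    fix B
    assume "B \<in> {B. True \<and> (\<nexists>B'. True \<and> norm (Y - S ** B') < norm (Y - S ** B))}"
    then show "B \<in> {C}"
      using less[of B] by blast
  next
    fix B
    assume "B \<in> {C}"
    then show "B \<in> {B. True \<and> (\<nexists>B'. True \<and> norm (Y - S ** B') < norm (Y - S ** B))}"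
      using le by (simp add: not_less)
  qed
qed

section \<open>Eigenvalues of symmetric definite pencils\<close>

definition pencil_eigenvalues :: "real^'m^'m \<Rightarrow> real^'m^'m \<Rightarrow> real set" where
  "pencil_eigenvalues K G = {\<mu>. \<exists>c. c \<noteq> 0 \<and> K *v c = \<mu> *\<^sub>R (G *v c)}"

lemma zero_notin_pencil_eigenvalues:
  assumes "spd_matrix K"
  shows "0 \<notin> pencil_eigenvalues K G"
  using spd_matrix_kernel[OF assms] by (auto simp: pencil_eigenvalues_def)

lemma pencil_eigenvalues_swap:
  fixes K G :: "real^'m^'m"
  assumes "spd_matrix K" and "spd_matrix G"
  shows "pencil_eigenvalues G K = inverse ` pencil_eigenvalues K G"
proof -
  have swap: "inverse \<mu> \<in> pencil_eigenvalues M N"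
    if \<mu>: "\<mu> \<in> pencil_eigenvalues N M" and N: "spd_matrix N"
    for \<mu> :: real and M N :: "real^'m^'m"
  proof -
    have "\<mu> \<noteq> 0"
      using \<mu> zero_notin_pencil_eigenvalues[OF N] by blast
    moreover obtain c where "c \<noteq> 0" "N *v c = \<mu> *\<^sub>R (M *v c)"
      using \<mu> by (auto simp: pencil_eigenvalues_def)
    ultimately show ?thesis
      by (auto simp: pencil_eigenvalues_def intro!: exI[of _ c])
  qed
  show ?thesis
  proof (intro equalityI subsetI)
    fix \<theta>
    assume "\<theta> \<in> pencil_eigenvalues G K"
    then have "inverse \<theta> \<in> pencil_eigenvalues K G"
      using swap assms(2) by blast
    then show "\<theta> \<in> inverse ` pencil_eigenvalues K G"
      by (rule rev_image_eqI) simp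
  qed (use swap assms(1) in blast)
qed

lemma complex_eigenvector_iff:
  fixes M :: "real^'m^'m" and u v :: "real^'m"
  defines "c \<equiv> \<chi> i. Complex (u $ i) (v $ i)"
  shows "map_matrix complex_of_real M *v c = \<mu> *s c \<longleftrightarrow>
    M *v u = Re \<mu> *\<^sub>R u - Im \<mu> *\<^sub>R v \<and> M *v v = Re \<mu> *\<^sub>R v + Im \<mu> *\<^sub>R u"
  by (auto simp: c_def vec_eq_iff matrix_vector_mult_def complex_eq_iff)

text \<open>
  Split an eigenvector into real and imaginary parts \<open>u\<close> and \<open>v\<close>, and let \<open>b\<close> be the imaginary
  part of the eigenvalue. Comparing \<open>v \<bullet> K u\<close> with \<open>u \<bullet> K v\<close>, equal by symmetry of \<open>K\<close>, and
  cancelling the terms \<open>v \<bullet> G u = u \<bullet> G v\<close> leaves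
  \<open>b (u \<bullet> G u + v \<bullet> G v) = 0\<close>, and definiteness of \<open>G\<close> forces \<open>b = 0\<close>. Then \<open>u\<close> and \<open>v\<close>
  separately solve the real eigenvalue equation, and one of them is nonzero.
\<close>

lemma matrix_eigenvalues_inverse_times:
  fixes K G :: "real^'m^'m"
  assumes K: "transpose K = K" and G: "spd_matrix G"
  shows "matrix_eigenvalues (matrix_inv G ** K) = complex_of_real ` pencil_eigenvalues K G"
proof -
  define M where "M = matrix_inv G ** K"
  have inv: "invertible G"
    by (rule spd_matrix_invertible[OF G])
  have M_iff: "M *v x = y \<longleftrightarrow> K *v x = G *v y" for x y
  proof -
    have "G *v (M *v x) = K *v x"
      using inv by (simp add: M_def matrix_vector_mul_assoc matrix_mul_assoc mult_matrix_inv)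
    moreover have "inj ((*v) G)"
      using inv matrix_left_invertible_injective[of G] by (auto simp: invertible_def)
    ultimately show ?thesis
      by (metis injD)
  qed
  have G_pos: "x \<bullet> (G *v x) > 0" if "x \<noteq> 0" for x
    using G that by (simp add: spd_matrix_def)
  have G_nonneg: "x \<bullet> (G *v x) \<ge> 0" for x
    using G_pos[of x] by (cases "x = 0") simp_all
  have G_sym: "transpose G = G"
    using G by (simp add: spd_matrix_def)
  show ?thesis
    unfolding M_def[symmetric]
  proof (intro equalityI subsetI)
    fix \<mu>
    assume "\<mu> \<in> matrix_eigenvalues M"
    then obtain c where c: "c \<noteq> 0" "map_matrix complex_of_real M *v c = \<mu> *s c"
      by (auto simp: matrix_eigenvalues_def)
    define u where "u = (\<chi> i. Re (c $ i))"
    define v where "v = (\<chi> i. Im (c $ i))"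
    have c_eq: "c = (\<chi> i. Complex (u $ i) (v $ i))"
      by (simp add: u_def v_def vec_eq_iff)
    have Ku: "K *v u = Re \<mu> *\<^sub>R (G *v u) - Im \<mu> *\<^sub>R (G *v v)"
      and Kv: "K *v v = Re \<mu> *\<^sub>R (G *v v) + Im \<mu> *\<^sub>R (G *v u)"
      using c(2) unfolding c_eq complex_eigenvector_iff M_iff by (simp_all add: algebra_simps)
    have uv: "u \<noteq> 0 \<or> v \<noteq> 0"
      using c(1) by (auto simp: c_eq vec_eq_iff complex_eq_iff)
    have "v \<bullet> (K *v u) = u \<bullet> (K *v v)"
      by (rule inner_symmetric_matrix[OF K])
    then have "Im \<mu> * (u \<bullet> (G *v u) + v \<bullet> (G *v v)) = 0"
      using inner_symmetric_matrix[OF G_sym, of u v]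
      by (simp add: Ku Kv inner_diff_right inner_add_right algebra_simps)
    moreover have "u \<bullet> (G *v u) + v \<bullet> (G *v v) > 0"
      using uv G_pos G_nonneg by (metis add_nonneg_pos add_pos_nonneg)
    ultimately have "Im \<mu> = 0"
      by simp
    with Ku Kv uv have "Re \<mu> \<in> pencil_eigenvalues K G"
      by (auto simp: pencil_eigenvalues_def)
    moreover have "\<mu> = complex_of_real (Re \<mu>)"
      using \<open>Im \<mu> = 0\<close> by (simp add: complex_eq_iff)
    ultimately show "\<mu> \<in> complex_of_real ` pencil_eigenvalues K G"
      by blast
  next
    fix \<mu>
    assume "\<mu> \<in> complex_of_real ` pencil_eigenvalues K G"
    then obtain \<theta> u where \<theta>: "\<mu> = complex_of_real \<theta>" "u \<noteq> 0" "K *v u = \<theta> *\<^sub>R (G *v u)"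
      by (auto simp: pencil_eigenvalues_def)
    then have "M *v u = \<theta> *\<^sub>R u"
      by (simp add: M_iff matrix_vector_mult_scaleR)
    then have "map_matrix complex_of_real M *v (\<chi> i. Complex (u $ i) (0 $ i)) =
        \<mu> *s (\<chi> i. Complex (u $ i) (0 $ i))"
      unfolding complex_eigenvector_iff by (simp add: \<theta>(1))
    moreover have "(\<chi> i. Complex (u $ i) (0 $ i)) \<noteq> 0"
      using \<theta>(2) by (auto simp: vec_eq_iff complex_eq_iff)
    ultimately show "\<mu> \<in> matrix_eigenvalues M"
      unfolding matrix_eigenvalues_def by blast
  qed
qed

section \<open>Ritz values as pencil eigenvalues\<close>

lemma span_columns_eq_range:
  fixes M :: "real^'m^'n"
  shows "span (columns M) = range ((*v) M)"
proof
  have "subspace (range ((*v) M))"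
    by (intro linear_subspace_image) auto
  then show "span (columns M) \<subseteq> range ((*v) M)"
    by (intro span_minimal) (auto simp: columns_image_basis)
  show "range ((*v) M) \<subseteq> span (columns M)"
    by (auto intro: matrix_vector_mult_in_columnspace)
qed

lemma orthogonal_comp_range_iff:
  fixes M :: "real^'m^'n"
  shows "w \<in> orthogonal_comp (range ((*v) M)) \<longleftrightarrow> transpose M *v w = 0"
proof -
  have "w \<in> orthogonal_comp (range ((*v) M)) \<longleftrightarrow> (\<forall>y. w \<bullet> (M *v y) = 0)"
    by (auto simp: orthogonal_comp_def orthogonal_def inner_commute)
  also have "\<dots> \<longleftrightarrow> transpose M *v w = 0"
    unfolding inner_matrix_vector_transpose by (metis inner_eq_zero_iff inner_zero_left)
  finally show ?thesis .
qed

text \<open>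
  Both kinds of Ritz values arise from a Galerkin condition with trial space \<open>range ((*v) S)\<close>; the
  test space is the range of \<open>W = S\<close> for Ritz values and of \<open>W = A ** S\<close> for harmonic ones.
\<close>

lemma petrov_galerkin_iff:
  fixes A :: "real^'n^'n" and S W :: "real^'m^'n"
  shows "A *v (S *v c) - \<theta> *\<^sub>R (S *v c) \<in> orthogonal_comp (range ((*v) W)) \<longleftrightarrow>
    (transpose W ** (A ** S)) *v c = \<theta> *\<^sub>R ((transpose W ** S) *v c)"
  unfolding orthogonal_comp_range_iff
  by (simp add: matrix_vector_mult_diff_distrib matrix_vector_mult_scaleR matrix_vector_mul_assoc
      matrix_mul_assoc del: transpose_matrix_vector)

lemma ritz_values_eq_pencil_eigenvalues:
  "ritz_values A S = pencil_eigenvalues (transpose S ** (A ** S)) (transpose S ** S)"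
  unfolding ritz_values_def pencil_eigenvalues_def span_columns_eq_range petrov_galerkin_iff ..

lemma harmonic_ritz_values_eq_pencil_eigenvalues:
  "harmonic_ritz_values A S =
    pencil_eigenvalues (transpose (A ** S) ** (A ** S)) (transpose (A ** S) ** S)"
proof -
  have "(*v) A ` range ((*v) S) = range ((*v) (A ** S))"
    by (simp add: image_image matrix_vector_mul_assoc)
  then show ?thesis
    unfolding harmonic_ritz_values_def pencil_eigenvalues_def span_columns_eq_range
    by (simp only: petrov_galerkin_iff)
qed

section \<open>Gradient differences in the quadratic case\<close>

lemma GDERIV_quadratic:
  assumes "transpose A = A"
  shows "GDERIV (quadratic A b) x :> A *v x - b"
proof -
  have "((\<lambda>x. 1/2 * (x \<bullet> (A *v x)) - b \<bullet> x) has_derivative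
      (\<lambda>h. 1/2 * (x \<bullet> (A *v h) + h \<bullet> (A *v x)) - b \<bullet> h)) (at x)"
    by (auto intro!: derivative_eq_intros
        bounded_linear.has_derivative[OF matrix_vector_mul_bounded_linear])
  also have "(\<lambda>h. 1/2 * (x \<bullet> (A *v h) + h \<bullet> (A *v x)) - b \<bullet> h) = (\<lambda>h. h \<bullet> (A *v x - b))"
    using inner_symmetric_matrix[OF assms, of x]
    by (simp add: fun_eq_iff inner_diff_right inner_commute[of b])
  finally show ?thesis
    by (simp add: gderiv_def quadratic_def[abs_def])
qed

text \<open>
  The gradients in the definition of the method are only constrained to be derivatives, so they
  have to be identified with \<open>A x - b\<close> by uniqueness.
\<close>

lemma GDERIV_unique:
  assumes "GDERIV f x :> d" and "GDERIV f x :> e"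
  shows "d = e"
proof -
  have "(\<lambda>h. h \<bullet> d) = (\<lambda>h. h \<bullet> e)"
    using assms unfolding gderiv_def by (rule has_derivative_unique)
  then show ?thesis
    by (metis vector_eq_ldot)
qed

lemma gradient_method_quadratic_differences:
  fixes A :: "real^'n^'n" and idx :: "'m::finite \<Rightarrow> nat"
  assumes A: "transpose A = A" and gm: "gradient_method (quadratic A b) m x g \<beta>"
    and idx: "range idx \<subseteq> {1..m}"
  shows "difference_matrix idx g = A ** difference_matrix idx x"
proof -
  have grad: "g k = A *v x k - b" if "k \<in> {1..m + 1}" for k
    using gm that GDERIV_unique[OF _ GDERIV_quadratic[OF A]] unfolding gradient_method_def by blast
  have "g (idx j + 1) - g (idx j) = A *v (x (idx j + 1) - x (idx j))" for j
  proof -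
    have "idx j \<in> {1..m}"
      using idx by blast
    then show ?thesis
      by (simp add: grad matrix_vector_mult_diff_distrib)
  qed
  then show ?thesis
    by (simp add: difference_matrix_def vec_eq_iff matrix_matrix_mult_def matrix_vector_mult_def)
qed

section \<open>Optimal matrices and Ritz values\<close>

theorem proposition3:
  fixes S Y :: "real^'m^'n"
  assumes "CARD('n) \<ge> CARD('m)" and "full_rank S" and "full_rank Y"
  shows
    "(invertible (transpose S ** S) \<and>
     {B :: real^'m^'m. is_arg_min (\<lambda>B. norm (Y - S ** B)) (\<lambda>_. True) B} =
       {matrix_inv (transpose S ** S) ** (transpose S ** Y)}) \<and>
     (invertible (transpose Y ** Y) \<and>
     {H :: real^'m^'m. is_arg_min (\<lambda>H. norm (Y ** H - S)) (\<lambda>_. True) H} =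
       {matrix_inv (transpose Y ** Y) ** (transpose Y ** S)}) \<and>
     (\<forall>(A :: real^'n^'n) (b :: real^'n) x g \<beta> (idx :: 'm \<Rightarrow> nat).
       spd_matrix A \<longrightarrow>
       gradient_method (quadratic A b) CARD('m) x g \<beta> \<longrightarrow>
       bij_betw idx UNIV {1..CARD('m)} \<longrightarrow>
       S = difference_matrix idx x \<longrightarrow>
       Y = difference_matrix idx g \<longrightarrow>
         Y = A ** S \<and>
         matrix_eigenvalues (matrix_inv (transpose S ** S) ** (transpose S ** Y)) =
           complex_of_real ` ritz_values A S \<and>
         0 \<notin> harmonic_ritz_values A S \<and>
         matrix_eigenvalues (matrix_inv (transpose Y ** Y) ** (transpose Y ** S)) =
           (\<lambda>\<theta>. complex_of_real (inverse \<theta>)) ` harmonic_ritz_values A S)"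
proof (intro conjI allI impI)
  have S: "inj ((*v) S)" and Y: "inj ((*v) Y)"
    using assms by (simp_all add: full_rank_imp_inj)
  show "invertible (transpose S ** S)" "invertible (transpose Y ** Y)"
    by (intro spd_matrix_invertible spd_gram_matrix S Y)+
  show "{B :: real^'m^'m. is_arg_min (\<lambda>B. norm (Y - S ** B)) (\<lambda>_. True) B} =
      {matrix_inv (transpose S ** S) ** (transpose S ** Y)}"
    by (rule least_squares_unique_minimizer[OF S])
  show "{H :: real^'m^'m. is_arg_min (\<lambda>H. norm (Y ** H - S)) (\<lambda>_. True) H} =
      {matrix_inv (transpose Y ** Y) ** (transpose Y ** S)}"
    using least_squares_unique_minimizer[OF Y, of S] by (simp add: norm_minus_commute)
  fix A :: "real^'n^'n" and b x g \<beta> and idx :: "'m \<Rightarrow> nat"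
  assume A: "spd_matrix A"
    and gm: "gradient_method (quadratic A b) CARD('m) x g \<beta>"
    and idx: "bij_betw idx UNIV {1..CARD('m)}"
    and SY: "S = difference_matrix idx x" "Y = difference_matrix idx g"
  have A_sym: "transpose A = A"
    using A by (simp add: spd_matrix_def)
  show Y_eq: "Y = A ** S"
    unfolding SY using idx
    by (intro gradient_method_quadratic_differences[OF A_sym gm]) (simp add: bij_betw_def)
  have YS: "transpose Y ** S = transpose S ** (A ** S)"
    by (simp add: Y_eq matrix_transpose_mul A_sym matrix_mul_assoc)
  define K where "K = transpose S ** (A ** S)"
  have K: "spd_matrix K"
    unfolding K_def by (rule spd_congruence[OF A S])
  then have K_sym: "transpose K = K"
    by (simp add: spd_matrix_def)
  have harmonic: "harmonic_ritz_values A S = pencil_eigenvalues (transpose Y ** Y) K"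
    unfolding harmonic_ritz_values_eq_pencil_eigenvalues Y_eq[symmetric] YS K_def ..
  show "matrix_eigenvalues (matrix_inv (transpose S ** S) ** (transpose S ** Y)) =
      complex_of_real ` ritz_values A S"
    using matrix_eigenvalues_inverse_times[OF K_sym spd_gram_matrix[OF S]]
    by (simp add: ritz_values_eq_pencil_eigenvalues K_def Y_eq)
  show "0 \<notin> harmonic_ritz_values A S"
    unfolding harmonic by (rule zero_notin_pencil_eigenvalues[OF spd_gram_matrix[OF Y]])
  have "matrix_eigenvalues (matrix_inv (transpose Y ** Y) ** (transpose Y ** S)) =
      complex_of_real ` pencil_eigenvalues K (transpose Y ** Y)"
    unfolding YS K_def[symmetric]
    by (rule matrix_eigenvalues_inverse_times[OF K_sym spd_gram_matrix[OF Y]])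
  also have "pencil_eigenvalues K (transpose Y ** Y) = inverse ` harmonic_ritz_values A S"
    unfolding harmonic by (rule pencil_eigenvalues_swap[OF spd_gram_matrix[OF Y] K])
  finally show "matrix_eigenvalues (matrix_inv (transpose Y ** Y) ** (transpose Y ** S)) =
      (\<lambda>\<theta>. complex_of_real (inverse \<theta>)) ` harmonic_ritz_values A S"
    by (simp add: image_image)
qed

end
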